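(* For every integer $n\ge1$, the bivariate Laurent polynomial $$\tilde a_n(z_1,z_2)=4\bigl(\sigma(z_1)\sigma(z_2)\bigr)^{\lceil n/2\rceil}\bigl(\sigma(z_1)\sigma(z_2)-\delta(z_1)\delta(z_2)\bigr)^{\lfloor n/2\rfloor},$$ where $\sigma(z)=\frac{(1+z)^2}{4z}$ and $\delta(z)=-\frac{(1-z)^2}{4z}$, generates polynomials up to degree $2n-1$ and reproduces polynomials up to degree $1$.
   Context: A symbol is a bivariate Laurent polynomial $a(z_1,z_2)$ with real coefficients, regarded as a function of $(z_1,z_2)\in(\mathbb C\setminus\{0\})^2$. For $k=(k_1,k_2)\in\mathbb N_0^2$, $D^k=\partial_{z_1}^{k_1}\partial_{z_2}^{k_2}$ and $|k|=k_1+k_2$. Let $E'=\{(-1,1),(1,-1),(-1,-1)\}$. Generates polynomials up to degree $m$: $(D^k a)(z)=0$ for all $z\in E'$ and all $k\in\mathbb N_0^2$ with $0\le|k|\le m$. Reproduces polynomials up to degree $m'$ (for a symbol that generates polynomials up to some degree $m\ge m'$): $a(1,1)=4$ and $(D^k a)(1,1)=0$ for all $k\in\mathbb N_0^2$ with $0<|k|\le m'$. The symbol $\tilde a_n$ equals $4B_{\lceil n/2\rceil,\lceil n/2\rceil,\lfloor n/2\rfloor}$, where $$B_{i,j,k}(z_1,z_2)=\Bigl(\frac{(1+z_1)^2}{4z_1}\Bigr)^i\Bigl(\frac{(1+z_2)^2}{4z_2}\Bigr)^j\Bigl(\frac{(1+z_1z_2)(z_1+z_2)}{4z_1z_2}\Bigr)^k$$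 is the (normalized) symbol of a four-directional box-spline; note $\sigma(z_1)\sigma(z_2)-\delta(z_1)\delta(z_2)=\frac{(1+z_1z_2)(z_1+z_2)}{4z_1z_2}$. *)

theory Defs
  imports "HOL-Analysis.Analysis"
begin

(* Symbols are viewed as functions of (z1, z2) with z1, z2 nonzero; values at points
   with z1 = 0 or z2 = 0 are irrelevant, since the predicates below only look at germs
   at points with nonzero coordinates. *)
definition is_symbol :: "(complex \<times> complex \<Rightarrow> complex) \<Rightarrow> bool" where
  "is_symbol a \<longleftrightarrow>
     (\<exists>(S :: (int \<times> int) set) (c :: int \<times> int \<Rightarrow> real). finite S \<and>
        (\<forall>z1 z2. z1 \<noteq> 0 \<longrightarrow> z2 \<noteq> 0 \<longrightarrow>
           a (z1, z2) = (\<Sum>(i, j)\<in>S. of_real (c (i, j)) * z1 powi i * z2 powi j)))"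

definition partial1 :: "(complex \<times> complex \<Rightarrow> complex) \<Rightarrow> complex \<times> complex \<Rightarrow> complex" where
  "partial1 a = (\<lambda>(z1, z2). deriv (\<lambda>w. a (w, z2)) z1)"

definition partial2 :: "(complex \<times> complex \<Rightarrow> complex) \<Rightarrow> complex \<times> complex \<Rightarrow> complex" where
  "partial2 a = (\<lambda>(z1, z2). deriv (\<lambda>w. a (z1, w)) z2)"

definition mixed_partial ::
  "nat \<times> nat \<Rightarrow> (complex \<times> complex \<Rightarrow> complex) \<Rightarrow> complex \<times> complex \<Rightarrow> complex" where
  "mixed_partial k a = (partial1 ^^ fst k) ((partial2 ^^ snd k) a)"

definition E' :: "(complex \<times> complex) set" where
  "E' = {(-1, 1), (1, -1), (-1, -1)}"

definition generates_polynomials :: "nat \<Rightarrow> (complex \<times> complex \<Rightarrow> complex) \<Rightarrow> bool" where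
  "generates_polynomials m a \<longleftrightarrow>
     (\<forall>z\<in>E'. \<forall>k :: nat \<times> nat. fst k + snd k \<le> m \<longrightarrow> mixed_partial k a z = 0)"

(* Reproduction is only defined for symbols that generate polynomials up to some
   degree at least m; this requirement is made part of the predicate. *)
definition reproduces_polynomials :: "nat \<Rightarrow> (complex \<times> complex \<Rightarrow> complex) \<Rightarrow> bool" where
  "reproduces_polynomials m a \<longleftrightarrow>
     (\<exists>m'\<ge>m. generates_polynomials m' a) \<and> a (1, 1) = 4 \<and>
     (\<forall>k :: nat \<times> nat. 0 < fst k + snd k \<and> fst k + snd k \<le> m \<longrightarrow>
        mixed_partial k a (1, 1) = 0)"

definition symb_sigma :: "complex \<Rightarrow> complex" where
  "symb_sigma z = (1 + z)\<^sup>2 / (4 * z)"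

definition symb_delta :: "complex \<Rightarrow> complex" where
  "symb_delta z = - ((1 - z)\<^sup>2 / (4 * z))"

definition a_tilde :: "nat \<Rightarrow> complex \<times> complex \<Rightarrow> complex" where
  "a_tilde n = (\<lambda>(z1, z2).
     4 * (symb_sigma z1 * symb_sigma z2) ^ nat \<lceil>real n / 2\<rceil> *
     (symb_sigma z1 * symb_sigma z2 - symb_delta z1 * symb_delta z2) ^ nat \<lfloor>real n / 2\<rfloor>)"

end

theory Submission
  imports Defs
begin

text \<open>
  Say that a Laurent polynomial vanishes to order \<open>m\<close> at \<open>p\<close> if it and its derivatives of order
  less than \<open>m\<close> vanish at \<open>p\<close>. By the Leibniz rule, orders add up under multiplication. At
  \<open>(-1, 1)\<close> and \<open>(1, -1)\<close> both \<open>\<sigma>(z\<^sub>1) \<sigma>(z\<^sub>2)\<close> and \<open>(1 + z\<^sub>1 z\<^sub>2) (z\<^sub>1 + z\<^sub>2)\<close> vanish to order 2, which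
  gives order \<open>2 (\<lceil>n/2\<rceil> + \<lfloor>n/2\<rfloor>) = 2 n\<close> in total; at \<open>(-1, -1)\<close> the first factor alone vanishes to
  order 4, which gives \<open>4 \<lceil>n/2\<rceil> \<ge> 2 n\<close>. For reproduction, \<open>\<sigma>(1) = 1\<close> and \<open>\<delta>(1) = 0\<close>, so on the
  lines \<open>z\<^sub>2 = 1\<close> and \<open>z\<^sub>1 = 1\<close> the symbol is \<open>4 \<sigma>\<^sup>n\<close>, and \<open>\<sigma>'(1) = 0\<close>.
\<close>

section \<open>Laurent polynomials and their closure under sums and products\<close>

text \<open>An inductive form of \<open>is_symbol\<close>, so that products and derivatives can be
  treated by rule induction. The rule \<open>laurent_cong\<close> makes values on the coordinate
  axes irrelevant, which admits quotients such as \<open>symb_sigma\<close>.\<close>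

inductive laurent :: "(complex \<times> complex \<Rightarrow> complex) \<Rightarrow> bool" where
  laurent_monom: "laurent (\<lambda>z. of_real c * fst z powi i * snd z powi j)"
| laurent_add: "laurent f \<Longrightarrow> laurent g \<Longrightarrow> laurent (\<lambda>z. f z + g z)"
| laurent_cong: "laurent f \<Longrightarrow> (\<And>z1 z2. z1 \<noteq> 0 \<Longrightarrow> z2 \<noteq> 0 \<Longrightarrow> f (z1, z2) = g (z1, z2)) \<Longrightarrow> laurent g"

lemma is_symbol_add:
  assumes "is_symbol f" "is_symbol g"
  shows "is_symbol (\<lambda>z. f z + g z)"
proof -
  from assms(1) obtain S c where S: "finite S"
    "\<And>z1 z2. z1 \<noteq> 0 \<Longrightarrow> z2 \<noteq> 0 \<Longrightarrow>
       f (z1, z2) = (\<Sum>(i, j)\<in>S. of_real (c (i, j)) * z1 powi i * z2 powi j)"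
    unfolding is_symbol_def by blast
  from assms(2) obtain T d where T: "finite T"
    "\<And>z1 z2. z1 \<noteq> 0 \<Longrightarrow> z2 \<noteq> 0 \<Longrightarrow>
       g (z1, z2) = (\<Sum>(i, j)\<in>T. of_real (d (i, j)) * z1 powi i * z2 powi j)"
    unfolding is_symbol_def by blast
  \<comment> \<open>Both coefficient families are extended by zero to the common support
    \<open>S \<union> T\<close>.\<close>
  define e where "e = (\<lambda>x. (if x \<in> S then c x else 0) + (if x \<in> T then d x else 0))"
  have "f (z1, z2) + g (z1, z2) = (\<Sum>(i, j)\<in>S \<union> T. of_real (e (i, j)) * z1 powi i * z2 powi j)"
    if "z1 \<noteq> 0" "z2 \<noteq> 0" for z1 z2
  proof -
    have "f (z1, z2) =
        (\<Sum>(i, j)\<in>S \<union> T. of_real (if (i, j) \<in> S then c (i, j) else 0) * z1 powi i * z2 powi j)"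
      unfolding S(2)[OF that] using S(1) T(1) by (intro sum.mono_neutral_cong_left) auto
    moreover have "g (z1, z2) =
        (\<Sum>(i, j)\<in>S \<union> T. of_real (if (i, j) \<in> T then d (i, j) else 0) * z1 powi i * z2 powi j)"
      unfolding T(2)[OF that] using S(1) T(1) by (intro sum.mono_neutral_cong_left) auto
    ultimately show ?thesis
      by (simp only: sum.distrib [symmetric])
         (intro sum.cong refl, auto simp: e_def algebra_simps)
  qed
  then show ?thesis
    unfolding is_symbol_def using S(1) T(1) by (intro exI[of _ "S \<union> T"] exI[of _ e]) auto
qed

lemma laurent_imp_is_symbol: "laurent f \<Longrightarrow> is_symbol f"
proof (induction rule: laurent.induct)
  case (laurent_monom c i j)
  show ?case
    unfolding is_symbol_def by (intro exI[of _ "{(i, j)}"] exI[of _ "\<lambda>_. c"]) auto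
next
  case (laurent_add f g)
  then show ?case by (intro is_symbol_add)
next
  case (laurent_cong f g)
  have "is_symbol f \<longleftrightarrow> is_symbol g"
    unfolding is_symbol_def using laurent_cong.hyps by simp
  then show ?case using laurent_cong.IH by simp
qed

text \<open>The monomial case of \<open>laurent_mult\<close>: products are handled by one induction
  for each factor.\<close>

lemma laurent_mult_monom:
  assumes "laurent f"
  shows "laurent (\<lambda>z. of_real c * fst z powi i * snd z powi j * f z)"
  using assms
proof (induction rule: laurent.induct)
  case (laurent_monom d k l)
  show ?case
    by (rule laurent_cong[OF laurent.laurent_monom[of "c * d" "i + k" "j + l"]])
       (simp add: power_int_add)
next
  case (laurent_add f g)
  show ?case
    by (rule laurent_cong[OF laurent.laurent_add[OF laurent_add.IH]]) (simp add: algebra_simps)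
next
  case (laurent_cong f g)
  show ?case
    by (rule laurent.laurent_cong[OF laurent_cong.IH]) (simp add: laurent_cong.hyps)
qed

lemma laurent_mult:
  assumes "laurent f" "laurent g"
  shows "laurent (\<lambda>z. f z * g z)"
  using assms(1)
proof (induction rule: laurent.induct)
  case (laurent_monom c i j)
  show ?case by (rule laurent_mult_monom[OF assms(2)])
next
  case (laurent_add f1 f2)
  show ?case
    by (rule laurent_cong[OF laurent.laurent_add[OF laurent_add.IH]]) (simp add: algebra_simps)
next
  case (laurent_cong f1 f2)
  show ?case
    by (rule laurent.laurent_cong[OF laurent_cong.IH]) (simp add: laurent_cong.hyps)
qed

lemma laurent_const: "laurent (\<lambda>z. of_real c)"
  using laurent_monom[of c 0 0] by simp

lemma laurent_one: "laurent (\<lambda>z. 1)"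
  using laurent_const[of 1] by simp

lemma laurent_fst: "laurent fst"
  using laurent_monom[of 1 1 0] by simp

lemma laurent_snd: "laurent snd"
  using laurent_monom[of 1 0 1] by simp

section \<open>Partial derivatives of Laurent polynomials\<close>

lemma laurent_differentiable:
  assumes "laurent f" "z1 \<noteq> 0" "z2 \<noteq> 0"
  shows "(\<lambda>w. f (w, z2)) field_differentiable at z1"
    and "(\<lambda>w. f (z1, w)) field_differentiable at z2"
  using assms
proof (induction arbitrary: z1 z2 rule: laurent.induct)
  case (laurent_monom c i j)
  {
    case 1
    then show ?case
      unfolding field_differentiable_def by (auto intro!: exI derivative_eq_intros)
  next
    case 2
    then show ?case
      unfolding field_differentiable_def by (auto intro!: exI derivative_eq_intros)
  }
next
  case (laurent_add f g)
  {
    case 1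
    then show ?case using laurent_add.IH by (intro field_differentiable_add) auto
  next
    case 2
    then show ?case using laurent_add.IH by (intro field_differentiable_add) auto
  }
next
  case (laurent_cong f g)
  {
    case 1
    then have "eventually (\<lambda>w. w \<noteq> 0) (nhds z1)" by (simp add: t1_space_nhds)
    then have "eventually (\<lambda>w. f (w, z2) = g (w, z2)) (nhds z1)"
      by eventually_elim (use 1 laurent_cong.hyps in auto)
    then show ?case
      using laurent_cong.IH(1)[OF 1] unfolding field_differentiable_def
      by (metis DERIV_cong_ev)
  next
    case 2
    then have "eventually (\<lambda>w. w \<noteq> 0) (nhds z2)" by (simp add: t1_space_nhds)
    then have "eventually (\<lambda>w. f (z1, w) = g (z1, w)) (nhds z2)"
      by eventually_elim (use 2 laurent_cong.hyps in auto)
    then show ?case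
      using laurent_cong.IH(2)[OF 2] unfolding field_differentiable_def
      by (metis DERIV_cong_ev)
  }
qed

text \<open>Being nonzero is an open condition, so the two functions agree near the point along each
  coordinate line, and \<open>deriv\<close> depends only on the germ.\<close>

lemma partial_cong:
  assumes eq: "\<And>z1 z2. z1 \<noteq> 0 \<Longrightarrow> z2 \<noteq> 0 \<Longrightarrow> f (z1, z2) = g (z1, z2)"
    and "z1 \<noteq> 0" "z2 \<noteq> 0"
  shows "partial1 f (z1, z2) = partial1 g (z1, z2)"
    and "partial2 f (z1, z2) = partial2 g (z1, z2)"
proof -
  have "eventually (\<lambda>w. w \<noteq> 0) (nhds z1)" using assms by (simp add: t1_space_nhds)
  then have "eventually (\<lambda>w. f (w, z2) = g (w, z2)) (nhds z1)"
    by eventually_elim (use assms in auto)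
  then show "partial1 f (z1, z2) = partial1 g (z1, z2)"
    unfolding partial1_def by (auto intro: deriv_cong_ev)
  have "eventually (\<lambda>w. w \<noteq> 0) (nhds z2)" using assms by (simp add: t1_space_nhds)
  then have "eventually (\<lambda>w. f (z1, w) = g (z1, w)) (nhds z2)"
    by eventually_elim (use assms in auto)
  then show "partial2 f (z1, z2) = partial2 g (z1, z2)"
    unfolding partial2_def by (auto intro: deriv_cong_ev)
qed

lemma partial_add:
  assumes "laurent f" "laurent g" "z1 \<noteq> 0" "z2 \<noteq> 0"
  shows "partial1 (\<lambda>z. f z + g z) (z1, z2) = partial1 f (z1, z2) + partial1 g (z1, z2)"
    and "partial2 (\<lambda>z. f z + g z) (z1, z2) = partial2 f (z1, z2) + partial2 g (z1, z2)"
  unfolding partial1_def partial2_def prod.case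
  by (rule deriv_add laurent_differentiable assms)+

lemma partial_mult:
  assumes "laurent f" "laurent g" "z1 \<noteq> 0" "z2 \<noteq> 0"
  shows "partial1 (\<lambda>z. f z * g z) (z1, z2) =
      f (z1, z2) * partial1 g (z1, z2) + partial1 f (z1, z2) * g (z1, z2)"
    and "partial2 (\<lambda>z. f z * g z) (z1, z2) =
      f (z1, z2) * partial2 g (z1, z2) + partial2 f (z1, z2) * g (z1, z2)"
  unfolding partial1_def partial2_def prod.case
  by (rule deriv_mult laurent_differentiable assms)+

lemma laurent_partial:
  assumes "laurent f"
  shows "laurent (partial1 f)" and "laurent (partial2 f)"
  using assms
proof (induction rule: laurent.induct)
  case (laurent_monom c i j)
  {
    case 1
    show ?case
    \<comment> \<open>For \<open>i = 0\<close> the exponent becomes \<open>-1\<close>, but the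
      coefficient is then zero.\<close>
    proof (rule laurent_cong[OF laurent.laurent_monom[of "c * of_int i" "i - 1" j]])
      fix z1 z2 :: complex assume "z1 \<noteq> 0" "z2 \<noteq> 0"
      then have "((\<lambda>w. of_real c * w powi i * z2 powi j) has_field_derivative
          of_real c * (of_int i * z1 powi (i - 1)) * z2 powi j) (at z1)"
        by (auto intro!: derivative_eq_intros)
      then show "of_real (c * of_int i) * fst (z1, z2) powi (i - 1) * snd (z1, z2) powi j =
          partial1 (\<lambda>z. of_real c * fst z powi i * snd z powi j) (z1, z2)"
        by (simp add: partial1_def DERIV_imp_deriv)
    qed
  next
    case 2
    show ?case
    proof (rule laurent_cong[OF laurent.laurent_monom[of "c * of_int j" i "j - 1"]])
      fix z1 z2 :: complex assume "z1 \<noteq> 0" "z2 \<noteq> 0"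
      then have "((\<lambda>w. of_real c * z1 powi i * w powi j) has_field_derivative
          of_real c * z1 powi i * (of_int j * z2 powi (j - 1))) (at z2)"
        by (auto intro!: derivative_eq_intros)
      then show "of_real (c * of_int j) * fst (z1, z2) powi i * snd (z1, z2) powi (j - 1) =
          partial2 (\<lambda>z. of_real c * fst z powi i * snd z powi j) (z1, z2)"
        by (simp add: partial2_def DERIV_imp_deriv)
    qed
  }
next
  case (laurent_add f g)
  {
    case 1
    show ?case
      by (rule laurent_cong[OF laurent.laurent_add[OF laurent_add.IH(1,3)]])
         (simp add: partial_add laurent_add.hyps)
  next
    case 2
    show ?case
      by (rule laurent_cong[OF laurent.laurent_add[OF laurent_add.IH(2,4)]])
         (simp add: partial_add laurent_add.hyps)
  }
next
  case (laurent_cong f g)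
  {
    case 1
    show ?case
      by (rule laurent.laurent_cong[OF laurent_cong.IH(1)])
         (rule partial_cong, auto simp: laurent_cong.hyps)
  next
    case 2
    show ?case
      by (rule laurent.laurent_cong[OF laurent_cong.IH(2)])
         (rule partial_cong, auto simp: laurent_cong.hyps)
  }
qed

section \<open>Order of vanishing at a point\<close>

primrec vanishes :: "complex \<times> complex \<Rightarrow> nat \<Rightarrow> (complex \<times> complex \<Rightarrow> complex) \<Rightarrow> bool" where
  "vanishes p 0 f \<longleftrightarrow> laurent f"
| "vanishes p (Suc m) f \<longleftrightarrow>
     laurent f \<and> f p = 0 \<and> vanishes p m (partial1 f) \<and> vanishes p m (partial2 f)"

lemma vanishes_imp_laurent: "vanishes p m f \<Longrightarrow> laurent f"
  by (cases m) auto

lemma vanishes_SucD: "vanishes p (Suc m) f \<Longrightarrow> vanishes p m f"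
proof (induction m arbitrary: f)
  case (Suc m)
  have "vanishes p (Suc m) (partial1 f)" "vanishes p (Suc m) (partial2 f)"
    using Suc.prems by simp_all
  from Suc.IH[OF this(1)] Suc.IH[OF this(2)] show ?case using Suc.prems by simp
qed simp

lemma vanishes_mono: "vanishes p m f \<Longrightarrow> k \<le> m \<Longrightarrow> vanishes p k f"
proof (induction m)
  case (Suc m)
  then show ?case
    using vanishes_SucD[OF Suc.prems(1)] by (cases "k = Suc m") (simp_all del: vanishes.simps)
qed simp

text \<open>Truncated subtraction covers \<open>m = 0\<close>, where only closure of
  \<open>laurent\<close> under derivatives is claimed.\<close>

lemma vanishes_partial:
  assumes "vanishes p m f"
  shows "vanishes p (m - 1) (partial1 f)" and "vanishes p (m - 1) (partial2 f)"
proof -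
  have "vanishes p (m - 1) (partial1 f) \<and> vanishes p (m - 1) (partial2 f)"
    using assms laurent_partial[of f] by (cases m) auto
  then show "vanishes p (m - 1) (partial1 f)" "vanishes p (m - 1) (partial2 f)" by simp_all
qed

lemma vanishes_cong:
  assumes "fst p \<noteq> 0" "snd p \<noteq> 0" "vanishes p m f"
    and "\<And>z1 z2. z1 \<noteq> 0 \<Longrightarrow> z2 \<noteq> 0 \<Longrightarrow> f (z1, z2) = g (z1, z2)"
  shows "vanishes p m g"
  using assms(3,4)
proof (induction m arbitrary: f g)
  case 0
  then show ?case by (auto intro: laurent_cong)
next
  case (Suc m)
  have "f p = g p" using Suc.prems(2)[of "fst p" "snd p"] assms(1,2) by simp
  moreover have "laurent g" using Suc.prems by (auto intro: laurent_cong)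
  moreover have "vanishes p m (partial1 g)"
    by (rule Suc.IH[of "partial1 f"]) (use Suc.prems in \<open>auto intro: partial_cong\<close>)
  moreover have "vanishes p m (partial2 g)"
    by (rule Suc.IH[of "partial2 f"]) (use Suc.prems in \<open>auto intro: partial_cong\<close>)
  ultimately show ?case using Suc.prems(1) by simp
qed

lemma vanishes_add:
  assumes "fst p \<noteq> 0" "snd p \<noteq> 0" "vanishes p m f" "vanishes p m g"
  shows "vanishes p m (\<lambda>z. f z + g z)"
  using assms(3,4)
proof (induction m arbitrary: f g)
  case 0
  then show ?case by (simp add: laurent_add)
next
  case (Suc m)
  then have fg: "laurent f" "laurent g" by auto
  have "vanishes p m (partial1 (\<lambda>z. f z + g z))"
    by (rule vanishes_cong[OF assms(1,2) Suc.IH[of "partial1 f" "partial1 g"]])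
       (use Suc.prems fg in \<open>auto simp: partial_add\<close>)
  moreover have "vanishes p m (partial2 (\<lambda>z. f z + g z))"
    by (rule vanishes_cong[OF assms(1,2) Suc.IH[of "partial2 f" "partial2 g"]])
       (use Suc.prems fg in \<open>auto simp: partial_add\<close>)
  ultimately show ?case using Suc.prems by (simp add: laurent_add)
qed

text \<open>Induction on the total order: in the Leibniz rule each summand differentiates one factor
  and so loses at most one order.\<close>

lemma vanishes_mult:
  assumes "fst p \<noteq> 0" "snd p \<noteq> 0" "vanishes p a f" "vanishes p b g"
  shows "vanishes p (a + b) (\<lambda>z. f z * g z)"
proof -
  have "vanishes p m (\<lambda>z. f z * g z)"
    if "vanishes p a f" "vanishes p b g" "m = a + b" for m a b f g
    using that
  proof (induction m arbitrary: a b f g)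
    case 0
    then show ?case by (simp add: laurent_mult)
  next
    case (Suc m)
    have fg: "laurent f" "laurent g" using Suc.prems by (auto dest: vanishes_imp_laurent)
    \<comment> \<open>If \<open>a = 0\<close>, differentiating \<open>f\<close> costs nothing, since
      \<open>f'\<close> still has order 0; then \<open>b = Suc m\<close>, and one order of
      \<open>g\<close> is given away instead.\<close>
    have left: "vanishes p m (\<lambda>z. f' z * g z)" if "vanishes p (a - 1) f'" for f'
    proof (cases a)
      case 0
      then show ?thesis
        using Suc.IH[of 0 f' m g] Suc.prems that
        by (auto dest: vanishes_SucD simp del: vanishes.simps(2))
    next
      case (Suc a')
      then show ?thesis using Suc.IH[of a' f' b g] Suc.prems that by simp
    qed
    have right: "vanishes p m (\<lambda>z. f z * g' z)" if "vanishes p (b - 1) g'" for g'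
    proof (cases b)
      case 0
      then show ?thesis
        using Suc.IH[of m f 0 g'] Suc.prems that
        by (auto dest: vanishes_SucD simp del: vanishes.simps(2))
    next
      case (Suc b')
      then show ?thesis using Suc.IH[of a f b' g'] Suc.prems that by simp
    qed
    have "vanishes p m (partial1 (\<lambda>z. f z * g z))"
      by (rule vanishes_cong[OF assms(1,2) vanishes_add[OF assms(1,2)
            right[OF vanishes_partial(1)] left[OF vanishes_partial(1)]]])
         (use Suc.prems fg in \<open>auto simp: partial_mult\<close>)
    moreover have "vanishes p m (partial2 (\<lambda>z. f z * g z))"
      by (rule vanishes_cong[OF assms(1,2) vanishes_add[OF assms(1,2)
            right[OF vanishes_partial(2)] left[OF vanishes_partial(2)]]])
         (use Suc.prems fg in \<open>auto simp: partial_mult\<close>)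
    \<comment> \<open>The total order is positive, so at least one factor has positive order and is
      zero at \<open>p\<close>.\<close>
    moreover have "f p * g p = 0"
      using Suc.prems by (cases a; cases b) auto
    ultimately show ?case using fg by (simp add: laurent_mult)
  qed
  then show ?thesis using assms(3,4) by blast
qed

lemma vanishes_power:
  assumes "fst p \<noteq> 0" "snd p \<noteq> 0" "vanishes p a f"
  shows "vanishes p (k * a) (\<lambda>z. f z ^ k)"
proof (induction k)
  case 0
  show ?case by (simp add: laurent_one)
next
  case (Suc k)
  then show ?case using vanishes_mult[OF assms Suc] by simp
qed

lemma vanishes_one: "laurent f \<Longrightarrow> f p = 0 \<Longrightarrow> vanishes p 1 f"
  by (simp add: laurent_partial)

text \<open>Each derivative costs one order, and the order that remains is still positive, which
  forces the value zero.\<close>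

lemma vanishes_mixed_partial:
  assumes "vanishes p m f" "fst k + snd k < m"
  shows "mixed_partial k f p = 0"
proof -
  have 2: "vanishes p (m - j) ((partial2 ^^ j) f)" for j
  proof (induction j)
    case (Suc j)
    then show ?case using vanishes_partial(2)[OF Suc] by simp
  qed (simp add: assms(1))
  have "vanishes p (m - snd k - i) ((partial1 ^^ i) ((partial2 ^^ snd k) f))" for i
  proof (induction i)
    case (Suc i)
    then show ?case using vanishes_partial(1)[OF Suc] by simp
  qed (simp add: 2)
  then have "vanishes p (m - snd k - fst k) (mixed_partial k f)"
    by (simp add: mixed_partial_def)
  moreover have "m - snd k - fst k = Suc (m - snd k - fst k - 1)"
    using assms(2) by simp
  ultimately show ?thesis by (metis vanishes.simps(2))
qed

section \<open>The two factors of the symbol and their orders on \<open>E'\<close>\<close>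

definition sigma_prod :: "complex \<times> complex \<Rightarrow> complex" where
  "sigma_prod z = symb_sigma (fst z) * symb_sigma (snd z)"

definition sigma_delta :: "complex \<times> complex \<Rightarrow> complex" where
  "sigma_delta z = sigma_prod z - symb_delta (fst z) * symb_delta (snd z)"

lemma a_tilde_eq:
  "a_tilde n = (\<lambda>z. 4 * (sigma_prod z ^ nat \<lceil>real n / 2\<rceil> * sigma_delta z ^ nat \<lfloor>real n / 2\<rfloor>))"
  by (auto simp: a_tilde_def sigma_prod_def sigma_delta_def)

text \<open>Off the axes, \<open>sigma_prod\<close> is the product of \<open>(1 + z1)^2\<close>,
  \<open>(1 + z2)^2\<close> and a monomial, which contributes order 0.\<close>

lemma vanishes_sigma_prod:
  assumes "fst p \<noteq> 0" "snd p \<noteq> 0"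
    and "vanishes p a (\<lambda>z. 1 + fst z)" "vanishes p b (\<lambda>z. 1 + snd z)"
  shows "vanishes p (2 * a + 2 * b) sigma_prod"
proof -
  note mult = vanishes_mult[OF assms(1,2)] and power = vanishes_power[OF assms(1,2)]
  have "vanishes p 0 (\<lambda>z. of_real (1/16) * fst z powi (-1) * snd z powi (-1))"
    using laurent_monom[of "1/16" "-1" "-1"] by simp
  from vanishes_cong[OF assms(1,2)
      mult[OF this mult[OF power[OF assms(3), of 2] power[OF assms(4), of 2]]], of sigma_prod]
  show ?thesis by (simp add: sigma_prod_def symb_sigma_def field_simps)
qed

text \<open>Uses the factorization \<open>(1 + z1 z2) (z1 + z2) / (4 z1 z2)\<close> of
  \<open>sigma_delta\<close>, a difference of the squares of \<open>(1 + z1) (1 + z2)\<close> and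
  \<open>(1 - z1) (1 - z2)\<close>, divided by \<open>16 z1 z2\<close>.\<close>

lemma vanishes_sigma_delta:
  assumes "fst p \<noteq> 0" "snd p \<noteq> 0"
    and "vanishes p a (\<lambda>z. 1 + fst z * snd z)" "vanishes p b (\<lambda>z. fst z + snd z)"
  shows "vanishes p (a + b) sigma_delta"
proof -
  note mult = vanishes_mult[OF assms(1,2)]
  have "vanishes p 0 (\<lambda>z. of_real (1/4) * fst z powi (-1) * snd z powi (-1))"
    using laurent_monom[of "1/4" "-1" "-1"] by simp
  from vanishes_cong[OF assms(1,2) mult[OF this mult[OF assms(3,4)]], of sigma_delta]
  show ?thesis
    by (simp add: sigma_delta_def sigma_prod_def symb_sigma_def symb_delta_def field_simps
        power2_eq_square)
qed

lemma vanishes_a_tilde: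
  assumes "fst p \<noteq> 0" "snd p \<noteq> 0" "vanishes p a sigma_prod" "vanishes p b sigma_delta"
  shows "vanishes p (nat \<lceil>real n / 2\<rceil> * a + nat \<lfloor>real n / 2\<rfloor> * b) (a_tilde n)"
proof -
  note mult = vanishes_mult[OF assms(1,2)] and power = vanishes_power[OF assms(1,2)]
  have "vanishes p 0 (\<lambda>z. 4)" using laurent_const[of 4] by simp
  from mult[OF this mult[OF power[OF assms(3)] power[OF assms(4)]]]
  show ?thesis unfolding a_tilde_eq by simp
qed

lemma nat_ceiling_floor_half:
  shows "nat \<lceil>real n / 2\<rceil> + nat \<lfloor>real n / 2\<rfloor> = n" and "n \<le> 2 * nat \<lceil>real n / 2\<rceil>"
proof -
  have "\<lfloor>real n / 2\<rfloor> = int n div 2"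
    using floor_divide_of_int_eq[of "int n" 2] by simp
  moreover have "\<lceil>real n / 2\<rceil> = - (- int n div 2)"
    using ceiling_divide_eq_div[of "int n" 2] by simp
  ultimately show "nat \<lceil>real n / 2\<rceil> + nat \<lfloor>real n / 2\<rfloor> = n" "n \<le> 2 * nat \<lceil>real n / 2\<rceil>"
    by linarith+
qed

lemma laurent_factors:
  "laurent (\<lambda>z. 1 + fst z)" "laurent (\<lambda>z. 1 + snd z)"
  "laurent (\<lambda>z. 1 + fst z * snd z)" "laurent (\<lambda>z. fst z + snd z)"
  using laurent_add[OF laurent_one laurent_fst] laurent_add[OF laurent_one laurent_snd]
    laurent_add[OF laurent_one laurent_mult[OF laurent_fst laurent_snd]]
    laurent_add[OF laurent_fst laurent_snd] by simp_all

lemma vanishes_a_tilde_E':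
  assumes "p \<in> E'"
  shows "vanishes p (2 * n) (a_tilde n)"
proof -
  have nz: "fst p \<noteq> 0" "snd p \<noteq> 0" using assms by (auto simp: E'_def)
  have factors0: "vanishes p 0 (\<lambda>z. 1 + fst z)" "vanishes p 0 (\<lambda>z. 1 + snd z)"
    "vanishes p 0 (\<lambda>z. 1 + fst z * snd z)" "vanishes p 0 (\<lambda>z. fst z + snd z)"
    by (simp_all add: laurent_factors)
  consider "p = (-1, -1)" | "p = (-1, 1) \<or> p = (1, -1)"
    using assms by (auto simp: E'_def)
  then show ?thesis
  proof cases
    case 1
    \<comment> \<open>Here \<open>(1 + z1 z2) (z1 + z2) = -4\<close>, so \<open>sigma_delta\<close>
      supplies only order 0 and \<open>sigma_prod\<close> must supply everything.\<close>
    have "vanishes p 1 (\<lambda>z. 1 + fst z)" "vanishes p 1 (\<lambda>z. 1 + snd z)"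
      by (rule vanishes_one; simp add: laurent_factors 1)+
    from vanishes_a_tilde[OF nz vanishes_sigma_prod[OF nz this]
        vanishes_sigma_delta[OF nz factors0(3,4)], of n]
    show ?thesis
      by (rule vanishes_mono) (use nat_ceiling_floor_half(2)[of n] in simp)
  next
    case 2
    \<comment> \<open>At both points \<open>z1 z2 = -1\<close> and
      \<open>z1 + z2 = 0\<close>.\<close>
    have "vanishes p 1 (\<lambda>z. 1 + fst z * snd z)" "vanishes p 1 (\<lambda>z. fst z + snd z)"
      by (rule vanishes_one; use 2 in \<open>auto simp: laurent_factors\<close>)+
    then have delta: "vanishes p 2 sigma_delta"
      using vanishes_sigma_delta[OF nz, of 1 1] by (simp add: numeral_2_eq_2)
    \<comment> \<open>Only one of the two linear factors vanishes, but it enters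
      \<open>sigma_prod\<close> squared.\<close>
    have "vanishes p 1 (\<lambda>z. 1 + fst z) \<or> vanishes p 1 (\<lambda>z. 1 + snd z)"
      using 2 vanishes_one[OF laurent_factors(1), of p] vanishes_one[OF laurent_factors(2), of p]
      by auto
    then have "vanishes p 2 sigma_prod"
      using vanishes_sigma_prod[OF nz _ factors0(2), of 1]
        vanishes_sigma_prod[OF nz factors0(1), of 1]
      by (auto simp: numeral_2_eq_2)
    from vanishes_a_tilde[OF nz this delta, of n]
    show ?thesis
      by (rule vanishes_mono) (use nat_ceiling_floor_half(1)[of n] in linarith)
  qed
qed

section \<open>First-order behaviour at \<open>(1, 1)\<close>\<close>

text \<open>Since \<open>symb_delta 1 = 0\<close>, both factors reduce to
  \<open>symb_sigma w\<close> and the exponents add up to \<open>n\<close>. First partials at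
  \<open>(1, 1)\<close> only see these two lines.\<close>

lemma a_tilde_line:
  "a_tilde n (w, 1) = 4 * symb_sigma w ^ n" "a_tilde n (1, w) = 4 * symb_sigma w ^ n"
proof -
  have "symb_sigma 1 = 1" "symb_delta 1 = 0"
    by (simp_all add: symb_sigma_def symb_delta_def)
  then show "a_tilde n (w, 1) = 4 * symb_sigma w ^ n" "a_tilde n (1, w) = 4 * symb_sigma w ^ n"
    by (simp_all add: a_tilde_def nat_ceiling_floor_half(1) mult.assoc flip: power_add)
qed

text \<open>The point 1 is critical for \<open>symb_sigma\<close>, because
  \<open>symb_sigma z = (z + 1/z + 2) / 4\<close> is invariant under inversion.\<close>

lemma deriv_sigma_power: "deriv (\<lambda>w. 4 * symb_sigma w ^ n) 1 = 0"
proof -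
  have "(symb_sigma has_field_derivative 0) (at 1)"
    unfolding symb_sigma_def by (auto intro!: derivative_eq_intros)
  then have "((\<lambda>w. 4 * symb_sigma w ^ n) has_field_derivative 0) (at 1)"
    by (auto intro!: derivative_eq_intros)
  then show ?thesis by (rule DERIV_imp_deriv)
qed

theorem proposition3p2:
  fixes n :: nat
  assumes "n \<ge> 1"
  shows "is_symbol (a_tilde n) \<and>
         generates_polynomials (2 * n - 1) (a_tilde n) \<and>
         reproduces_polynomials 1 (a_tilde n)"
proof (intro conjI)
  \<comment> \<open>Any point of \<open>E'\<close> would do, as \<open>vanishes\<close> includes
    \<open>laurent\<close>.\<close>
  have "laurent (a_tilde n)"
    using vanishes_a_tilde_E'[of "(-1, -1)" n] by (auto simp: E'_def dest: vanishes_imp_laurent)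
  then show "is_symbol (a_tilde n)" by (rule laurent_imp_is_symbol)
  show gen: "generates_polynomials (2 * n - 1) (a_tilde n)"
    unfolding generates_polynomials_def
    using assms by (auto intro!: vanishes_mixed_partial[OF vanishes_a_tilde_E'])
  have "mixed_partial k (a_tilde n) (1, 1) = 0" if "0 < fst k + snd k" "fst k + snd k \<le> 1" for k
  proof -
    have "k = (1, 0) \<or> k = (0, 1)" using that by (cases k) auto
    then show ?thesis
      by (auto simp: mixed_partial_def partial1_def partial2_def a_tilde_line deriv_sigma_power)
  qed
  moreover have "a_tilde n (1, 1) = 4"
    by (simp add: a_tilde_line symb_sigma_def)
  \<comment> \<open>This makes \<open>2 * n - 1\<close> a valid witness for the degree of generation
    that reproduction requires.\<close>
  moreover have "1 \<le> 2 * n - 1" using assms by simp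
  ultimately show "reproduces_polynomials 1 (a_tilde n)"
    unfolding reproduces_polynomials_def using gen
    by (intro conjI allI impI exI[of _ "2 * n - 1"]) auto
qed

end
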